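(* Let $f$ be a piecewise smooth function over a mesh with edge-length measure $h$. In a neighborhood of a $C^0$ discontinuity of $f$, the difference between the quadratic weighted-least-squares (WLS) fitting of $f$ and the linear interpolation of $f$ is $\mathcal{O}(1)$. In a neighborhood of a $C^1$ discontinuity of $f$, this difference is $\mathcal{O}(h)$.
   Context: All asymptotic statements are as the mesh is refined, i.e. $h\to 0$. A $C^0$ discontinuity is a discontinuity (jump) in the function values. A $C^1$ discontinuity is a discontinuity in the derivatives (gradient) of the function, where the function itself is continuous. Quadratic WLS: given a point $\boldsymbol{x}_0$ and a stencil of nearby sample points $\{\boldsymbol{x}_i\}$ (mesh nodes) with values $f_i=f(\boldsymbol{x}_i)$, $f$ is approximated near $\boldsymbol{x}_0$ by a polynomial of degree at most $2$, $f_Q(\boldsymbol{x})=f(\boldsymbol{x}_0)+\boldsymbol{h}^T\tilde{\boldsymbol{g}}+\frac12\boldsymbol{h}^T\tilde{\boldsymbol{H}}\boldsymbol{h}$ with $\boldsymbol{h}=\boldsymbol{x}-\boldsymbol{x}_0$, whose coefficients minimize $\Vert\boldsymbol{W}(\boldsymbol{A}\boldsymbol{c}-\boldsymbol{f})\Vert_2$. Here $\boldsymbol{A}$ is the generalized Vandermonde matrix (monomials of degree at most 2 at the stencil points), $\boldsymbol{f}$ is the vector of sampled values, and $\boldsymbol{W}$ is a diagonal matrix of weights that depend only on the distances and not on $f$. On a surface mesh, local planar coordinates obtained by projection onto the plane orthogonal to the normal at the center point are used. Stencils are chosen with enough points that the scaled Vandermonde matrix is well conditioned (condition number bounded independently of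 $h$). The components of $\tilde{\boldsymbol{g}}$ and $\tilde{\boldsymbol{H}}$ are linear combinations of the $f_i$ with coefficients, independent of $f$, of magnitude $\Theta(1/h)$ and $\Theta(1/h^2)$, respectively. Linear interpolation is the element-wise linear interpolant of nodal values on triangles (bilinear on quadrilaterals). *)

theory Defs
  imports "HOL-Analysis.Analysis"
begin

section \<open>Domains and piecewise smooth functions\<close>

text \<open>For \<^term>\<open>k \<ge> (1::nat)\<close> this is \<open>C\<^sup>k\<close> regularity on an open set \<open>U\<close>: continuity of all
  directional derivatives of order at most \<open>k\<close>.\<close>

fun Ck_on :: "nat \<Rightarrow> ('a::real_normed_vector \<Rightarrow> 'b::real_normed_vector) \<Rightarrow> 'a set \<Rightarrow> bool" where
  "Ck_on 0 f U \<longleftrightarrow> continuous_on U f"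
| "Ck_on (Suc k) f U \<longleftrightarrow>
     (\<forall>x\<in>U. f differentiable (at x)) \<and> (\<forall>v. Ck_on k (\<lambda>x. frechet_derivative f (at x) v) U)"

text \<open>A \<open>C\<^sup>k\<close> surface in space, possibly with a Lipschitz boundary (corners are allowed). Near each of
  its points it is the image, under a regular \<open>C\<^sup>k\<close> parametrization of a disc, of the part of the disc
  above the graph of a Lipschitz function \<open>\<gamma>\<close>. Boundary points have \<open>\<gamma> 0 = 0\<close>; at interior points one
  may take \<open>\<gamma>\<close> constantly \<open>-1\<close>, which leaves the whole disc. Planar regions are the case of a
  surface contained in a plane.\<close>

definition lipschitz_surface :: "nat \<Rightarrow> (real^3) set \<Rightarrow> bool" where
  "lipschitz_surface k \<Gamma> \<longleftrightarrow>
     (\<forall>p\<in>\<Gamma>. \<exists>(X :: real^2 \<Rightarrow> real^3) Y (\<gamma> :: real \<Rightarrow> real) L U.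
        Ck_on k X (ball 0 1) \<and>
        (\<forall>u\<in>ball 0 1. inj (frechet_derivative X (at u))) \<and>
        X 0 = p \<and> L-lipschitz_on UNIV \<gamma> \<and> \<gamma> 0 \<le> 0 \<and> open U \<and>
        homeomorphism {u \<in> ball 0 1. \<gamma> (u$1) \<le> u$2} (\<Gamma> \<inter> U) X Y)"

text \<open>\<open>n\<close> is a unit vector whose orthogonal plane through \<open>x\<close> is tangent to \<open>\<Gamma>\<close> at \<open>x\<close>.\<close>

definition unit_normal :: "(real^3) set \<Rightarrow> real^3 \<Rightarrow> real^3 \<Rightarrow> bool" where
  "unit_normal \<Gamma> x n \<longleftrightarrow>
     norm n = 1 \<and> ((\<lambda>y. (n \<bullet> (y - x)) / norm (y - x)) \<longlongrightarrow> 0) (at x within \<Gamma>)"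

definition tangent_plane :: "(real^3) set \<Rightarrow> real^3 \<Rightarrow> (real^3) set" where
  "tangent_plane \<Gamma> x = {v. \<forall>n. unit_normal \<Gamma> x n \<longrightarrow> n \<bullet> v = 0}"

definition has_surface_gradient ::
    "(real^3 \<Rightarrow> real) \<Rightarrow> (real^3) set \<Rightarrow> real^3 \<Rightarrow> real^3 \<Rightarrow> bool" where
  "has_surface_gradient f \<Gamma> x g \<longleftrightarrow>
     g \<in> tangent_plane \<Gamma> x \<and> (f has_derivative (\<lambda>v. g \<bullet> v)) (at x within \<Gamma>)"

text \<open>Finitely many pieces cover \<open>\<Gamma>\<close>, and on each of them \<open>f\<close> is smooth up to the boundary of the
  piece. A piece lies in the closure of its interior relative to \<open>\<Gamma>\<close>; the values of \<open>f\<close> on an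
  interface may come from either side.\<close>

definition piecewise_smooth :: "nat \<Rightarrow> (real^3 \<Rightarrow> real) \<Rightarrow> (real^3) set \<Rightarrow> bool" where
  "piecewise_smooth k f \<Gamma> \<longleftrightarrow>
     (\<exists>\<P>. finite \<P> \<and> \<Union>\<P> = \<Gamma> \<and>
        (\<forall>P\<in>\<P>. P \<subseteq> closure ((top_of_set \<Gamma>) interior_of P) \<and>
           (\<exists>V \<phi>. open V \<and> closure P \<subseteq> V \<and> Ck_on k \<phi> V \<and> (\<forall>x\<in>P. f x = \<phi> x))))"

definition C0_discontinuity :: "(real^3 \<Rightarrow> real) \<Rightarrow> (real^3) set \<Rightarrow> real^3 \<Rightarrow> bool" where
  "C0_discontinuity f \<Gamma> p \<longleftrightarrow> p \<in> \<Gamma> \<and> \<not> continuous (at p within \<Gamma>) f"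

text \<open>\<open>f\<close> is continuous near \<open>p\<close>, but it has no gradient field near \<open>p\<close> that is continuous at \<open>p\<close>.
  Continuity at \<open>p\<close> alone would not do: a jump across a curve may vanish at the single point \<open>p\<close>.\<close>

definition C1_discontinuity :: "(real^3 \<Rightarrow> real) \<Rightarrow> (real^3) set \<Rightarrow> real^3 \<Rightarrow> bool" where
  "C1_discontinuity f \<Gamma> p \<longleftrightarrow>
     p \<in> \<Gamma> \<and>
     (\<exists>V. open V \<and> p \<in> V \<and> continuous_on (\<Gamma> \<inter> V) f) \<and>
     \<not> (\<exists>V G. open V \<and> p \<in> V \<and> (\<forall>x\<in>\<Gamma> \<inter> V. has_surface_gradient f \<Gamma> x (G x)) \<and>
          continuous (at p within \<Gamma>) G)"


section \<open>Meshes and linear interpolation\<close>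

text \<open>An element is the list of its vertices, in cyclic order: three for a triangle, four for a
  quadrilateral. It is parametrized over a reference cell by the linear, respectively bilinear,
  shape functions.\<close>

definition ref_cell :: "'v list \<Rightarrow> (real \<times> real) set" where
  "ref_cell \<sigma> =
     (if length \<sigma> = 3 then {(a, b). 0 \<le> a \<and> 0 \<le> b \<and> a + b \<le> 1} else {0..1} \<times> {0..1})"

definition shape_functions :: "'v list \<Rightarrow> real \<times> real \<Rightarrow> real list" where
  "shape_functions \<sigma> \<xi> = (case \<xi> of (a, b) \<Rightarrow>
     if length \<sigma> = 3 then [1 - a - b, a, b]
     else [(1 - a) * (1 - b), a * (1 - b), a * b, (1 - a) * b])"

definition elem_interp :: "'v list \<Rightarrow> ('v \<Rightarrow> 'b::real_vector) \<Rightarrow> real \<times> real \<Rightarrow> 'b" where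
  "elem_interp \<sigma> F \<xi> = (\<Sum>i<length \<sigma>. (shape_functions \<sigma> \<xi> ! i) *\<^sub>R F (\<sigma> ! i))"

abbreviation elem_point :: "(real^3) list \<Rightarrow> real \<times> real \<Rightarrow> real^3" where
  "elem_point \<sigma> \<equiv> elem_interp \<sigma> (\<lambda>v. v)"

definition cell :: "(real^3) list \<Rightarrow> (real^3) set" where
  "cell \<sigma> = elem_point \<sigma> ` ref_cell \<sigma>"

text \<open>Conforming meshes with vertices on \<open>\<Gamma>\<close>. Injectivity of the reference map is nondegeneracy of
  the element. Distinct elements meet in the empty set, a common vertex or a common edge.\<close>

definition is_mesh :: "(real^3) set \<Rightarrow> (real^3) list set \<Rightarrow> bool" where
  "is_mesh \<Gamma> M \<longleftrightarrow>
     finite M \<and> M \<noteq> {} \<and>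
     (\<forall>\<sigma>\<in>M. length \<sigma> \<in> {3, 4} \<and> set \<sigma> \<subseteq> \<Gamma> \<and> inj_on (elem_point \<sigma>) (ref_cell \<sigma>)) \<and>
     (\<forall>\<sigma>\<in>M. \<forall>\<tau>\<in>M. \<sigma> \<noteq> \<tau> \<longrightarrow>
        card (set \<sigma> \<inter> set \<tau>) \<le> 2 \<and> cell \<sigma> \<inter> cell \<tau> = convex hull (set \<sigma> \<inter> set \<tau>))"

definition mesh_nodes :: "(real^3) list set \<Rightarrow> (real^3) set" where
  "mesh_nodes M = (\<Union>\<sigma>\<in>M. set \<sigma>)"

definition edge_lengths :: "(real^3) list set \<Rightarrow> real set" where
  "edge_lengths M =
     {dist (\<sigma> ! i) (\<sigma> ! (Suc i mod length \<sigma>)) | \<sigma> i. \<sigma> \<in> M \<and> i < length \<sigma>}"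

text \<open>\<open>h\<close> is comparable to the largest edge length. Quasi-uniformity is not required.\<close>

definition edge_length_measure :: "real \<Rightarrow> (real^3) list set \<Rightarrow> real \<Rightarrow> bool" where
  "edge_length_measure \<rho> M h \<longleftrightarrow>
     0 < h \<and> Max (edge_lengths M) \<le> \<rho> * h \<and> h \<le> \<rho> * Max (edge_lengths M)"


section \<open>Condition numbers\<close>

text \<open>Matrices are functions on explicit finite index sets: \<open>R\<close> for the rows, \<open>J\<close> for the columns.\<close>

definition mat_apply :: "'j set \<Rightarrow> ('i \<Rightarrow> 'j \<Rightarrow> real) \<Rightarrow> ('j \<Rightarrow> real) \<Rightarrow> 'i \<Rightarrow> real" where
  "mat_apply J B c i = (\<Sum>j\<in>J. B i j * c j)"

definition max_singular_value :: "'i set \<Rightarrow> 'j set \<Rightarrow> ('i \<Rightarrow> 'j \<Rightarrow> real) \<Rightarrow> real" where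
  "max_singular_value R J B = (SUP c\<in>{c. L2_set c J = 1}. L2_set (mat_apply J B c) R)"

definition min_singular_value :: "'i set \<Rightarrow> 'j set \<Rightarrow> ('i \<Rightarrow> 'j \<Rightarrow> real) \<Rightarrow> real" where
  "min_singular_value R J B = (INF c\<in>{c. L2_set c J = 1}. L2_set (mat_apply J B c) R)"

text \<open>The first conjunct (full column rank) excludes the case where the quotient is a division by
  zero.\<close>

definition condition_number_le :: "'i set \<Rightarrow> 'j set \<Rightarrow> ('i \<Rightarrow> 'j \<Rightarrow> real) \<Rightarrow> real \<Rightarrow> bool" where
  "condition_number_le R J B \<kappa> \<longleftrightarrow>
     0 < min_singular_value R J B \<and>
     max_singular_value R J B / min_singular_value R J B \<le> \<kappa>"


section \<open>Quadratic weighted least squares\<close>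

text \<open>The data of a fit, none of which involves the function to be fitted. The weight of a node
  is \<open>weight\<close> applied to its distance from the center; the local coordinate axes are \<open>axis1\<close> and
  \<open>axis2\<close>.\<close>

record wls_stencil =
  center :: "real^3"
  nodes :: "(real^3) set"
  weight :: "real \<Rightarrow> real"
  axis1 :: "real^3"
  axis2 :: "real^3"

definition local_coords :: "wls_stencil \<Rightarrow> real^3 \<Rightarrow> real^2" where
  "local_coords s x = vector [axis1 s \<bullet> (x - center s), axis2 s \<bullet> (x - center s)]"

definition node_weight :: "wls_stencil \<Rightarrow> real^3 \<Rightarrow> real" where
  "node_weight s x = weight s (dist (center s) x)"

definition tangent_frame :: "(real^3) set \<Rightarrow> wls_stencil \<Rightarrow> bool" where
  "tangent_frame \<Gamma> s \<longleftrightarrow>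
     norm (axis1 s) = 1 \<and> norm (axis2 s) = 1 \<and> axis1 s \<bullet> axis2 s = 0 \<and>
     (\<exists>n. unit_normal \<Gamma> (center s) n \<and> n \<bullet> axis1 s = 0 \<and> n \<bullet> axis2 s = 0)"

text \<open>Exponents of the monomials of degree at most 2 in two variables.\<close>

definition quad_exps :: "(nat \<times> nat) set" where
  "quad_exps = {(0,0), (1,0), (0,1), (2,0), (1,1), (0,2)}"

definition vandermonde :: "wls_stencil \<Rightarrow> real^3 \<Rightarrow> nat \<times> nat \<Rightarrow> real" where
  "vandermonde s x \<alpha> = (local_coords s x $ 1) ^ fst \<alpha> * (local_coords s x $ 2) ^ snd \<alpha>"

text \<open>The least-squares matrix \<open>W A\<close> with the column of each monomial of degree \<open>d\<close> divided by
  \<open>h\<^sup>d\<close>.\<close>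

definition scaled_vandermonde :: "real \<Rightarrow> wls_stencil \<Rightarrow> real^3 \<Rightarrow> nat \<times> nat \<Rightarrow> real" where
  "scaled_vandermonde h s x \<alpha> = node_weight s x * vandermonde s x \<alpha> / h ^ (fst \<alpha> + snd \<alpha>)"

definition admissible_stencil ::
    "(real^3) set \<Rightarrow> (real^3) list set \<Rightarrow> real \<Rightarrow> real \<Rightarrow> real \<Rightarrow> wls_stencil \<Rightarrow> bool" where
  "admissible_stencil \<Gamma> M h \<rho> \<kappa> s \<longleftrightarrow>
     center s \<in> \<Gamma> \<and>
     nodes s \<subseteq> mesh_nodes M \<and>
     (\<forall>x\<in>nodes s. dist (center s) x \<le> \<rho> * h) \<and>
     (\<forall>d. 0 \<le> weight s d) \<and>
     tangent_frame \<Gamma> s \<and>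
     condition_number_le (nodes s) quad_exps (scaled_vandermonde h s) \<kappa>"

text \<open>The weighted residual norm \<open>\<parallel>W (A c - f)\<parallel>\<^sub>2\<close>.\<close>

definition wls_residual ::
    "wls_stencil \<Rightarrow> (real^3 \<Rightarrow> real) \<Rightarrow> (nat \<times> nat \<Rightarrow> real) \<Rightarrow> real" where
  "wls_residual s f c =
     L2_set (\<lambda>x. node_weight s x * (mat_apply quad_exps (vandermonde s) c x - f x)) (nodes s)"

text \<open>There are two conventions for the constant coefficient: either it is prescribed to be the
  value of \<open>f\<close> at the center (\<open>interp\<close> true), or it is fitted with the others (\<open>interp\<close> false).\<close>

definition wls_fit ::
    "bool \<Rightarrow> wls_stencil \<Rightarrow> (real^3 \<Rightarrow> real) \<Rightarrow> (nat \<times> nat \<Rightarrow> real) \<Rightarrow> bool" where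
  "wls_fit interp s f c \<longleftrightarrow>
     (interp \<longrightarrow> c (0,0) = f (center s)) \<and>
     (\<forall>c'. (interp \<longrightarrow> c' (0,0) = f (center s)) \<longrightarrow> wls_residual s f c \<le> wls_residual s f c')"

definition fit_gradient :: "(nat \<times> nat \<Rightarrow> real) \<Rightarrow> real^2" where
  "fit_gradient c = vector [c (1,0), c (0,1)]"

definition fit_hessian :: "(nat \<times> nat \<Rightarrow> real) \<Rightarrow> real^2^2" where
  "fit_hessian c = vector [vector [2 * c (2,0), c (1,1)], vector [c (1,1), 2 * c (0,2)]]"

definition fit_eval :: "wls_stencil \<Rightarrow> (nat \<times> nat \<Rightarrow> real) \<Rightarrow> real^3 \<Rightarrow> real" where
  "fit_eval s c x =
     (let u = local_coords s x
      in c (0,0) + u \<bullet> fit_gradient c + 1/2 * (u \<bullet> (fit_hessian c *v u)))"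

lemma fit_eval_eq_vandermonde: "fit_eval s c x = mat_apply quad_exps (vandermonde s) c x"
  by (simp add: fit_eval_def mat_apply_def quad_exps_def vandermonde_def fit_gradient_def
      fit_hessian_def Let_def inner_vec_def matrix_vector_mult_def sum_2 vector_2
      power2_eq_square algebra_simps)


section \<open>The difference of the two approximations\<close>

text \<open>The difference of quadratic fit and linear interpolant is \<open>O(b)\<close> as \<open>n \<rightarrow> \<infinity>\<close>, uniformly over
  the points of the mesh in \<open>U\<close> and over the fits of \<open>f\<close> centered at distance \<open>O(h)\<close> from them. The
  implied constant may depend on \<open>\<rho>\<close> and \<open>\<kappa>\<close>.\<close>

definition fit_interp_difference_bigo ::
    "(real^3) set \<Rightarrow> (real^3 \<Rightarrow> real) \<Rightarrow> (nat \<Rightarrow> (real^3) list set) \<Rightarrow> (nat \<Rightarrow> real) \<Rightarrow>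
     real \<Rightarrow> real \<Rightarrow> (real^3) set \<Rightarrow> (nat \<Rightarrow> real) \<Rightarrow> bool" where
  "fit_interp_difference_bigo \<Gamma> f M h \<rho> \<kappa> U b \<longleftrightarrow>
     (\<exists>C. \<forall>\<^sub>F n in sequentially.
        \<forall>\<sigma>\<in>M n. \<forall>\<xi>\<in>ref_cell \<sigma>. \<forall>s interp c.
          elem_point \<sigma> \<xi> \<in> U \<longrightarrow>
          admissible_stencil \<Gamma> (M n) (h n) \<rho> \<kappa> s \<longrightarrow>
          dist (center s) (elem_point \<sigma> \<xi>) \<le> \<rho> * h n \<longrightarrow>
          wls_fit interp s f c \<longrightarrow>
          \<bar>fit_eval s c (elem_point \<sigma> \<xi>) - elem_interp \<sigma> f \<xi>\<bar> \<le> C * \<bar>b n\<bar>)"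

end

theory Submission
  imports Defs
begin

text \<open>Subtract the value of \<open>f\<close> at the stencil center. Constants are reproduced exactly by the fit,
  so comparing the minimizer with the constant competitor bounds the weighted residual by the
  oscillation of \<open>f\<close> over the stencil times the norm of the weights. The weights are the constant
  column of the scaled Vandermonde matrix, so their norm is at most the largest singular value, and
  the condition number turns this into a bound on the scaled coefficients that does not depend on
  \<open>h\<close>. Hence the difference of fit and interpolant is bounded by a multiple of the
  oscillation of \<open>f\<close> over a region of diameter \<open>O(h)\<close>. A piecewise smooth function is bounded, which
  settles \<open>C\<^sup>0\<close> discontinuities. Where it is continuous it is even locally Lipschitz, since nearby
  points of a Lipschitz surface are joined within the surface by paths of comparable length, along
  which finitely many Lipschitz pieces fit together; this settles \<open>C\<^sup>1\<close> discontinuities.\<close>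

section \<open>Local estimates for continuously differentiable maps\<close>

lemma Ck_on_imp_continuous_on:
  assumes "Ck_on k f V"
  shows "continuous_on V f"
proof (cases k)
  case (Suc j)
  then show ?thesis
    using assms by (auto intro!: continuous_at_imp_continuous_on differentiable_imp_continuous_within)
qed (use assms in simp)

text \<open>Strict differentiability at \<open>a\<close>. \<open>Ck_on\<close> controls the
  derivative one direction at a time; in finite dimension, continuity in the basis directions
  already makes it close to the derivative at \<open>a\<close> in operator norm on a ball. The mean
  value inequality is then applied to \<open>f\<close> minus its derivative at \<open>a\<close>. The
  upper and lower distance estimates for charts both come from here.\<close>

lemma C1_strict_derivative:
  fixes f :: "'a::euclidean_space \<Rightarrow> 'b::real_normed_vector"
  assumes "Ck_on k f V" "1 \<le> k" "open V" "a \<in> V" "0 < e"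
  obtains r where "0 < r" "ball a r \<subseteq> V"
    "\<And>x y. x \<in> ball a r \<Longrightarrow> y \<in> ball a r \<Longrightarrow>
       norm (f x - f y - frechet_derivative f (at a) (x - y)) \<le> e * norm (x - y)"
proof -
  let ?D = "\<lambda>x. frechet_derivative f (at x)"
  let ?N = "real DIM('a)"
  obtain j where k: "k = Suc j"
    using assms(2) by (cases k) auto
  have der: "(f has_derivative ?D x) (at x)" if "x \<in> V" for x
    using assms(1) that unfolding k by (simp add: frechet_derivative_works)
  have cont: "continuous_on V (\<lambda>x. ?D x v)" for v
    using assms(1) Ck_on_imp_continuous_on unfolding k Ck_on.simps by blast
  have "\<forall>\<^sub>F x in nhds a. x \<in> V \<and> (\<forall>b\<in>Basis. norm (?D x b - ?D a b) < e / ?N)"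
  proof (intro eventually_conj eventually_ball_finite ballI)
    show "\<forall>\<^sub>F x in nhds a. x \<in> V"
      using assms(3,4) by (rule eventually_nhds_in_open)
    fix b :: 'a
    have "((\<lambda>x. ?D x b) \<longlongrightarrow> ?D a b) (nhds a)"
      using cont[of b] assms(3,4)
      by (metis continuous_at_imp_continuous_on continuous_on_eq_continuous_at isCont_def tendsto_at_iff_tendsto_nhds)
    then show "\<forall>\<^sub>F x in nhds a. norm (?D x b - ?D a b) < e / ?N"
      using assms(5) by (auto simp: tendsto_iff dist_norm)
  qed simp
  then obtain r where r: "0 < r" and
    rV: "\<And>x. dist x a < r \<Longrightarrow> x \<in> V" and
    rb: "\<And>x b. dist x a < r \<Longrightarrow> b \<in> Basis \<Longrightarrow> norm (?D x b - ?D a b) < e / ?N"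
    unfolding eventually_nhds_metric by blast
  have lin: "linear (?D x)" if "x \<in> V" for x
    using der[OF that] has_derivative_linear by blast
  have bound: "onorm (\<lambda>v. ?D x v - ?D a v) \<le> e" if "dist x a < r" for x
  proof (rule onorm_bound)
    fix v :: 'a
    have l: "linear (\<lambda>v. ?D x v - ?D a v)"
      using lin[OF rV[OF that]] lin[OF assms(4)] by (rule linear_compose_sub)
    have "?D x v - ?D a v = (\<Sum>b\<in>Basis. (v \<bullet> b) *\<^sub>R (?D x b - ?D a b))"
      using linear_sum[OF l, of "\<lambda>b. (v \<bullet> b) *\<^sub>R b" Basis]
      by (simp add: euclidean_representation linear_scale[OF l])
    then have "norm (?D x v - ?D a v) = norm (\<Sum>b\<in>Basis. (v \<bullet> b) *\<^sub>R (?D x b - ?D a b))"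
      by (rule arg_cong)
    \<comment> \<open>The tolerance \<open>e / ?N\<close> was chosen for this sum: it has
      \<open>?N\<close> terms, each at most \<open>norm v * (e / ?N)\<close>.\<close>
    also have "\<dots> \<le> (\<Sum>b\<in>(Basis::'a set). norm v * (e / ?N))"
    proof (rule sum_norm_le)
      fix b :: 'a assume b: "b \<in> Basis"
      have "\<bar>v \<bullet> b\<bar> * norm (?D x b - ?D a b) \<le> norm v * (e / ?N)"
        using rb[OF that b] Basis_le_norm[OF b, of v] by (intro mult_mono) auto
      then show "norm ((v \<bullet> b) *\<^sub>R (?D x b - ?D a b)) \<le> norm v * (e / ?N)"
        by simp
    qed
    finally show "norm (?D x v - ?D a v) \<le> e * norm v"
      by (simp add: mult.commute)
  qed (use assms(5) in simp)
  show thesis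
  proof (rule that[OF r])
    show "ball a r \<subseteq> V"
      using rV by (auto simp: dist_commute)
    fix x y assume xy: "x \<in> ball a r" "y \<in> ball a r"
    have "norm ((f x - ?D a x) - (f y - ?D a y)) \<le> e * norm (x - y)"
    proof (rule differentiable_bound[OF convex_ball[of a r]])
      fix z assume z: "z \<in> ball a r"
      then have "z \<in> V"
        using rV by (auto simp: dist_commute)
      then show "((\<lambda>z. f z - ?D a z) has_derivative (\<lambda>v. ?D z v - ?D a v)) (at z within ball a r)"
        using linear_imp_has_derivative[OF lin[OF assms(4)]]
        by (intro has_derivative_diff has_derivative_at_withinI[OF der])
      show "onorm (\<lambda>v. ?D z v - ?D a v) \<le> e"
        using z by (intro bound) (simp add: dist_commute)
    qed (use xy in auto)
    then show "norm (f x - f y - ?D a (x - y)) \<le> e * norm (x - y)"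
      by (simp add: linear_diff[OF lin[OF assms(4)]] algebra_simps)
  qed
qed

text \<open>Strict differentiability with error 1 adds 1 to a bound \<open>B\<close> for the
  derivative at \<open>a\<close>.\<close>

lemma C1_locally_lipschitz:
  fixes f :: "'a::euclidean_space \<Rightarrow> 'b::real_normed_vector"
  assumes "Ck_on k f V" "1 \<le> k" "open V" "a \<in> V"
  obtains r K where "0 < r" "ball a r \<subseteq> V" "K-lipschitz_on (ball a r) f"
proof -
  obtain r where r: "0 < r" "ball a r \<subseteq> V" and
    D: "\<And>x y. x \<in> ball a r \<Longrightarrow> y \<in> ball a r \<Longrightarrow>
       norm (f x - f y - frechet_derivative f (at a) (x - y)) \<le> 1 * norm (x - y)"
    using C1_strict_derivative[OF assms zero_less_one] by metis
  obtain j where "k = Suc j"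
    using assms(2) by (cases k) auto
  then have "f differentiable (at a)"
    using assms by simp
  then have "bounded_linear (frechet_derivative f (at a))"
    by (metis frechet_derivative_works has_derivative_bounded_linear)
  then obtain B where B: "0 \<le> B" "\<And>v. norm (frechet_derivative f (at a) v) \<le> norm v * B"
    using bounded_linear.nonneg_bounded by metis
  have "(B + 1)-lipschitz_on (ball a r) f"
  proof (rule lipschitz_onI)
    fix x y assume "x \<in> ball a r" "y \<in> ball a r"
    from D[OF this] B(2)[of "x - y"] show "dist (f x) (f y) \<le> (B + 1) * dist x y"
      using norm_triangle_sub[of "f x - f y" "frechet_derivative f (at a) (x - y)"]
      by (simp add: dist_norm algebra_simps)
  qed (use B in simp)
  with r show thesis
    by (rule that)
qed

text \<open>An injective linear map in finite dimension stretches every vector by at least some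
  factor \<open>B > 0\<close>; an error of \<open>B / 2\<close> in strict differentiability leaves
  the factor \<open>B / 2\<close>. For a surface chart this bounds parameter distances by distances
  in space.\<close>

lemma C1_immersion_locally_injective:
  fixes f :: "'a::euclidean_space \<Rightarrow> 'b::euclidean_space"
  assumes "Ck_on k f V" "1 \<le> k" "open V" "a \<in> V" "inj (frechet_derivative f (at a))"
  obtains r m where "0 < r" "0 < m" "ball a r \<subseteq> V"
    "\<And>x y. x \<in> ball a r \<Longrightarrow> y \<in> ball a r \<Longrightarrow> m * dist x y \<le> dist (f x) (f y)"
proof -
  obtain j where "k = Suc j"
    using assms(2) by (cases k) auto
  then have "f differentiable (at a)"
    using assms by simp
  then have "linear (frechet_derivative f (at a))"
    by (rule linear_frechet_derivative)
  then obtain B where B: "0 < B" "\<And>v. B * norm v \<le> norm (frechet_derivative f (at a) v)"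
    using linear_inj_bounded_below_pos[OF _ assms(5)] by metis
  obtain r where r: "0 < r" "ball a r \<subseteq> V" and
    D: "\<And>x y. x \<in> ball a r \<Longrightarrow> y \<in> ball a r \<Longrightarrow>
       norm (f x - f y - frechet_derivative f (at a) (x - y)) \<le> (B / 2) * norm (x - y)"
    using C1_strict_derivative[OF assms(1-4) half_gt_zero[OF B(1)]] by metis
  show thesis
  proof (rule that[OF r(1) half_gt_zero[OF B(1)] r(2)])
    fix x y assume "x \<in> ball a r" "y \<in> ball a r"
    from D[OF this] B(2)[of "x - y"] show "B / 2 * dist x y \<le> dist (f x) (f y)"
      using norm_triangle_sub[of "frechet_derivative f (at a) (x - y)" "f x - f y"]
      by (simp add: dist_norm norm_minus_commute)
  qed
qed

section \<open>Short paths in a Lipschitz surface\<close>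

text \<open>The segment from \<open>u\<close> to \<open>v\<close> may dip below the graph, so it is
  lifted by a parabola vanishing at both ends. The slope of the lift is at most
  \<open>2 * L * dist u v\<close>, and its height is at most \<open>4 * L * r\<close> because
  \<open>dist u v \<le> 2 * r\<close>; this explains both constants.\<close>

lemma above_lipschitz_graph_quasiconvex:
  fixes u v :: "real^2" and \<gamma> :: "real \<Rightarrow> real"
  assumes \<gamma>: "L-lipschitz_on UNIV \<gamma>" and u: "\<gamma> (u$1) \<le> u$2" and v: "\<gamma> (v$1) \<le> v$2"
    and r: "norm u < r" "norm v < r"
  obtains w :: "real \<Rightarrow> real^2" where "w 0 = u" "w 1 = v"
    "((1 + 2 * L) * dist u v)-lipschitz_on {0..1} w"
    "\<And>t. t \<in> {0..1} \<Longrightarrow> \<gamma> (w t $ 1) \<le> w t $ 2 \<and> norm (w t) < (1 + 4 * L) * r"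
proof -
  have L: "0 \<le> L"
    using \<gamma> by (rule lipschitz_on_nonneg)
  have \<gamma>': "\<gamma> a \<le> \<gamma> b + L * \<bar>a - b\<bar>" for a b
    using lipschitz_onD[OF \<gamma>, of a b] by (simp add: dist_real_def)
  define q where "q = \<bar>u$1 - v$1\<bar>"
  have q: "0 \<le> q" "q \<le> dist u v"
    using component_le_norm_cart[of "u - v" 1] by (auto simp: q_def dist_norm)
  define e where "e = (axis 2 1 :: real^2)"
  have e: "norm e = 1" "e $ 1 = 0" "e $ 2 = 1"
    by (simp_all add: e_def norm_axis_1) (simp_all add: axis_def)
  \<comment> \<open>The bump is the convex combination of the two Lipschitz bounds for \<open>\<gamma>\<close> from \<open>u\<close> and from \<open>v\<close>.\<close>
  define w where "w t = u + t *\<^sub>R (v - u) + (2 * L * q * (t * (1 - t))) *\<^sub>R e" for t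
  show thesis
  proof (rule that)
    show "w 0 = u" "w 1 = v"
      by (auto simp: w_def)
    show "((1 + 2 * L) * dist u v)-lipschitz_on {0..1} w"
    proof (rule lipschitz_onI)
      fix s t :: real assume st: "s \<in> {0..1}" "t \<in> {0..1}"
      have "w s - w t = (s - t) *\<^sub>R (v - u) + (2 * L * q * ((s - t) * (1 - s - t))) *\<^sub>R e"
        by (simp add: w_def algebra_simps flip: scaleR_add_left)
      also have "norm \<dots> \<le> \<bar>s - t\<bar> * dist u v + (2 * L * q) * (\<bar>s - t\<bar> * \<bar>1 - s - t\<bar>)"
        using L q by (intro norm_triangle_le) (simp add: e dist_norm norm_minus_commute abs_mult)
      also have "\<dots> \<le> \<bar>s - t\<bar> * dist u v + (2 * L * dist u v) * (\<bar>s - t\<bar> * 1)"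
        using L q st by (intro add_mono mult_mono order_refl) auto
      finally show "dist (w s) (w t) \<le> (1 + 2 * L) * dist u v * dist s t"
        by (simp add: dist_norm algebra_simps)
    qed (use L in simp)
    fix t :: real assume t: "t \<in> {0..1}"
    have a: "w t $ 1 - u $ 1 = t * (v $ 1 - u $ 1)" "w t $ 1 - v $ 1 = (1 - t) * (u $ 1 - v $ 1)"
      by (auto simp: w_def e algebra_simps)
    have "\<gamma> (w t $ 1) \<le> u $ 2 + L * (t * q)" "\<gamma> (w t $ 1) \<le> v $ 2 + L * ((1 - t) * q)"
      using \<gamma>'[of "w t $ 1" "u $ 1"] \<gamma>'[of "w t $ 1" "v $ 1"] u v t
      unfolding a by (auto simp: abs_mult q_def abs_minus_commute)
    then have "(1 - t) * \<gamma> (w t $ 1) + t * \<gamma> (w t $ 1)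
        \<le> (1 - t) * (u $ 2 + L * (t * q)) + t * (v $ 2 + L * ((1 - t) * q))"
      using t by (intro add_mono mult_left_mono) auto
    then have "\<gamma> (w t $ 1) \<le> w t $ 2"
      by (simp add: w_def e algebra_simps)
    moreover have "norm (w t) < (1 + 4 * L) * r"
    proof -
      have "u + t *\<^sub>R (v - u) \<in> ball 0 r"
        using convexD_alt[OF convex_ball[of 0 r], of u v t] r t by (simp add: algebra_simps)
      moreover have "norm ((2 * L * q * (t * (1 - t))) *\<^sub>R e) \<le> 2 * L * (2 * r) * (1 * 1)"
      proof -
        have "dist u v \<le> 2 * r"
          using norm_triangle_ineq4[of u v] r by (simp add: dist_norm)
        then have "2 * L * q * (t * (1 - t)) \<le> 2 * L * (2 * r) * (1 * 1)"
          using L q t by (intro mult_mono) auto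
        then show ?thesis
          using L q t by (simp add: e)
      qed
      ultimately show ?thesis
        using norm_triangle_ineq[of "u + t *\<^sub>R (v - u)" "(2 * L * q * (t * (1 - t))) *\<^sub>R e"]
        by (simp add: w_def algebra_simps)
    qed
    ultimately show "\<gamma> (w t $ 1) \<le> w t $ 2 \<and> norm (w t) < (1 + 4 * L) * r"
      by blast
  qed
qed


text \<open>A chart is bi-Lipschitz near the parameter of \<open>p\<close>, so the paths above the
  graph are carried to the surface with length still comparable to the distance of their ends.
  Keeping them in \<open>ball p \<epsilon>\<close> allows local bounds on \<open>f\<close> to be
  used along them.\<close>

lemma lipschitz_surface_quasiconvex:
  assumes "lipschitz_surface k \<Gamma>" "1 \<le> k" "p \<in> \<Gamma>" "0 < \<epsilon>"
  obtains \<delta> K where "0 < \<delta>" "0 \<le> K"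
    "\<And>x y. x \<in> \<Gamma> \<inter> ball p \<delta> \<Longrightarrow> y \<in> \<Gamma> \<inter> ball p \<delta> \<Longrightarrow>
       \<exists>g. g 0 = x \<and> g 1 = y \<and> (K * dist x y)-lipschitz_on {0..1::real} g \<and> g ` {0..1} \<subseteq> \<Gamma> \<inter> ball p \<epsilon>"
proof -
  obtain X :: "real^2 \<Rightarrow> real^3" and Y \<gamma> L U where
    X: "Ck_on k X (ball 0 1)" "\<And>u. u \<in> ball 0 1 \<Longrightarrow> inj (frechet_derivative X (at u))" "X 0 = p" and
    \<gamma>: "L-lipschitz_on UNIV \<gamma>" "\<gamma> 0 \<le> 0" and U: "open U" and
    hom: "homeomorphism {u \<in> ball 0 1. \<gamma> (u$1) \<le> u$2} (\<Gamma> \<inter> U) X Y"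
    using bspec[OF assms(1)[unfolded lipschitz_surface_def] assms(3)] by blast
  let ?S = "{u \<in> ball 0 1. \<gamma> (u$1) \<le> u$2}"
  have L: "0 \<le> L"
    using \<gamma>(1) by (rule lipschitz_on_nonneg)
  have 0: "(0::real^2) \<in> ball 0 1" "(0::real^2) \<in> ?S"
    using \<gamma>(2) by auto
  obtain r1 m where m: "0 < r1" "0 < m"
    "\<And>x y. x \<in> ball 0 r1 \<Longrightarrow> y \<in> ball 0 r1 \<Longrightarrow> m * dist x y \<le> dist (X x) (X y)"
    using C1_immersion_locally_injective[OF X(1) assms(2) open_ball 0(1) X(2)[OF 0(1)]] by metis
  obtain r2 B where B: "0 < r2" "B-lipschitz_on (ball 0 r2) X"
    using C1_locally_lipschitz[OF X(1) assms(2) open_ball 0(1)] by metis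
  have B0: "0 \<le> B"
    using B(2) by (rule lipschitz_on_nonneg)
  \<comment> \<open>On \<open>ball 0 R\<close> both distance estimates for \<open>X\<close> hold,
    the chart is defined, and \<open>X\<close> moves points less than \<open>\<epsilon>\<close> away
    from \<open>p\<close>. The summand 1 in \<open>B + 1\<close> keeps the quotient meaningful for
    \<open>B = 0\<close> and makes that last inequality strict.\<close>
  define R where "R = min (min r1 r2) (min 1 (\<epsilon> / (B + 1)))"
  have R: "0 < R" "R \<le> r1" "R \<le> r2" "R \<le> 1" "B * R < \<epsilon>"
  proof -
    show "0 < R" "R \<le> r1" "R \<le> r2" "R \<le> 1"
      using m B assms(4) B0 by (auto simp: R_def)
    have "(B + 1) * R \<le> \<epsilon>"
      using B0 mult_left_mono[of R "\<epsilon> / (B + 1)" "B + 1"] by (simp add: R_def)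
    then show "B * R < \<epsilon>"
      using \<open>0 < R\<close> by (simp add: algebra_simps)
  qed
  \<comment> \<open>Parameter paths between points of norm below \<open>r\<close> reach norm at most
    \<open>(1 + 4 * L) * r\<close>, which is to be \<open>R\<close>.\<close>
  define r where "r = R / (1 + 4 * L)"
  have r: "0 < r" "(1 + 4 * L) * r = R"
    using R L by (auto simp: r_def)
  have "r \<le> R"
    unfolding r(2)[symmetric] using L r(1) by (simp add: algebra_simps)
  have Y: "Y p = 0" "continuous_on (\<Gamma> \<inter> U) Y" "\<And>x. x \<in> \<Gamma> \<inter> U \<Longrightarrow> Y x \<in> ?S \<and> X (Y x) = x"
    using homeomorphism_apply1[OF hom 0(2)] X(3) homeomorphism_cont2[OF hom]
      homeomorphism_apply2[OF hom] homeomorphism_image2[OF hom] by (simp, simp, blast)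
  have p: "p \<in> \<Gamma> \<inter> U"
    using homeomorphism_image1[OF hom] 0(2) X(3) by blast
  \<comment> \<open>Continuity of the inverse chart: points of the surface close to \<open>p\<close>
    in space have parameters close to 0.\<close>
  obtain \<delta>1 where \<delta>1: "0 < \<delta>1" "\<And>x. x \<in> \<Gamma> \<inter> U \<Longrightarrow> dist x p < \<delta>1 \<Longrightarrow> dist (Y x) (Y p) < r"
    using Y(2) p r(1) unfolding continuous_on_iff by metis
  obtain \<delta>2 where \<delta>2: "0 < \<delta>2" "ball p \<delta>2 \<subseteq> U"
    using U p openE by blast
  show thesis
  proof (rule that)
    show "0 < min \<delta>1 \<delta>2"
      using \<delta>1 \<delta>2 by simp
    show "0 \<le> B * ((1 + 2 * L) / m)"
      using B0 L m by simp
    fix x y assume xy: "x \<in> \<Gamma> \<inter> ball p (min \<delta>1 \<delta>2)" "y \<in> \<Gamma> \<inter> ball p (min \<delta>1 \<delta>2)"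
    then have xyU: "x \<in> \<Gamma> \<inter> U" "y \<in> \<Gamma> \<inter> U"
      using \<delta>2 by auto
    define u v where "u = Y x" and "v = Y y"
    have u: "norm u < r" "\<gamma> (u$1) \<le> u$2" "X u = x" and v: "norm v < r" "\<gamma> (v$1) \<le> v$2" "X v = y"
      using \<delta>1(2)[OF xyU(1)] \<delta>1(2)[OF xyU(2)] Y(3)[OF xyU(1)] Y(3)[OF xyU(2)] xy
      by (auto simp: u_def v_def Y(1) dist_commute)
    obtain w :: "real \<Rightarrow> real^2" where w: "w 0 = u" "w 1 = v"
      "((1 + 2 * L) * dist u v)-lipschitz_on {0..1} w"
      "\<And>t. t \<in> {0..1} \<Longrightarrow> \<gamma> (w t $ 1) \<le> w t $ 2 \<and> norm (w t) < R"
      using above_lipschitz_graph_quasiconvex[OF \<gamma>(1) u(2) v(2) u(1) v(1)] unfolding r(2) by blast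
    have sub: "w ` {0..1} \<subseteq> ball 0 R"
      using w(4) by auto
    have lip: "(B * ((1 + 2 * L) * dist u v))-lipschitz_on {0..1} (\<lambda>t. X (w t))"
      by (rule lipschitz_on_compose2[OF w(3)])
        (rule lipschitz_on_subset[OF B(2)], use sub R in auto)
    have "dist u v \<le> dist x y / m"
      using m(3)[of u v] u v \<open>r \<le> R\<close> R m(2) by (simp add: field_simps)
    then have "B * ((1 + 2 * L) * dist u v) \<le> B * ((1 + 2 * L) * (dist x y / m))"
      using B0 L by (intro mult_left_mono) auto
    then have "(B * ((1 + 2 * L) / m) * dist x y)-lipschitz_on {0..1} (\<lambda>t. X (w t))"
      by (intro lipschitz_on_le[OF lip]) simp
    moreover have "X (w t) \<in> \<Gamma> \<inter> ball p \<epsilon>" if t: "t \<in> {0..1}" for t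
    proof
      have "w t \<in> ?S"
        using w(4)[OF t] R by simp
      then show "X (w t) \<in> \<Gamma>"
        using homeomorphism_image1[OF hom] by blast
      have "dist (X 0) (X (w t)) \<le> B * dist 0 (w t)"
        using R w(4)[OF t] by (intro lipschitz_onD[OF B(2)]) auto
      also have "\<dots> \<le> B * R"
        using B0 w(4)[OF t] by (intro mult_left_mono) auto
      finally show "X (w t) \<in> ball p \<epsilon>"
        using R X(3) by simp
    qed
    ultimately show "\<exists>g. g 0 = x \<and> g 1 = y \<and>
        (B * ((1 + 2 * L) / m) * dist x y)-lipschitz_on {0..1::real} g \<and> g ` {0..1} \<subseteq> \<Gamma> \<inter> ball p \<epsilon>"
      using w(1,2) u(3) v(3) by (intro exI[of _ "\<lambda>t. X (w t)"]) auto
  qed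
qed

section \<open>Piecewise smooth functions: boundedness and local Lipschitz continuity\<close>

text \<open>At a limit point of \<open>P\<close> both functions are the limit of the same values
  along \<open>P\<close>. Thus, where \<open>f\<close> is continuous, its value on an interface
  agrees with the smooth extension from each adjacent piece, and pieces may be replaced by their
  closures.\<close>

lemma eq_on_closure_of_piece:
  fixes f \<phi> :: "'a::metric_space \<Rightarrow> 'b::t2_space"
  assumes "P \<subseteq> \<Gamma>" "continuous_on (\<Gamma> \<inter> V) f" "open V" "continuous_on W \<phi>" "open W"
    "\<And>x. x \<in> P \<Longrightarrow> f x = \<phi> x" "x \<in> closure P" "x \<in> \<Gamma> \<inter> V \<inter> W"
  shows "f x = \<phi> x"
proof (cases "x \<in> P")
  case False
  then have nb: "at x within P \<noteq> bot"
    using assms(7) by (simp add: closure_def trivial_limit_within)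
  have eq: "at x within \<Gamma> \<inter> V = at x within \<Gamma>"
    using assms(3,8) by (intro at_within_nhd[of x V]) auto
  have "(f \<longlongrightarrow> f x) (at x within \<Gamma>)"
    using assms(2,8) by (simp add: continuous_on_def flip: eq)
  then have f: "(f \<longlongrightarrow> f x) (at x within P)"
    using assms(1) by (rule tendsto_within_subset)
  have "isCont \<phi> x"
    using assms(4,5,8) by (simp add: continuous_on_eq_continuous_at)
  then have "(\<phi> \<longlongrightarrow> \<phi> x) (at x within P)"
    by (simp add: continuous_at_imp_continuous_at_within flip: continuous_within)
  moreover have "\<forall>\<^sub>F y in at x within P. f y = \<phi> y"
    using assms(6) by (simp add: eventually_at_filter)
  ultimately have "(f \<longlongrightarrow> \<phi> x) (at x within P)"
    by (simp add: tendsto_cong)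
  with nb f show ?thesis
    by (rule tendsto_unique)
qed (use assms(6) in blast)

text \<open>On each of the finitely many pieces, \<open>f\<close> takes values of a function that is
  continuous on the compact closure of the piece.\<close>

lemma piecewise_smooth_bounded:
  assumes "piecewise_smooth k f \<Gamma>" "compact \<Gamma>"
  obtains C where "\<And>x. x \<in> \<Gamma> \<Longrightarrow> \<bar>f x\<bar> \<le> C"
proof -
  obtain \<P> where \<P>: "finite \<P>" "\<Union>\<P> = \<Gamma>"
    "\<And>P. P \<in> \<P> \<Longrightarrow> \<exists>V \<phi>. open V \<and> closure P \<subseteq> V \<and> Ck_on k \<phi> V \<and> (\<forall>x\<in>P. f x = \<phi> x)"
    using assms(1) unfolding piecewise_smooth_def by blast
  have "bounded (f ` P)" if P: "P \<in> \<P>" for P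
  proof -
    obtain V \<phi> where V: "closure P \<subseteq> V" "Ck_on k \<phi> V" "\<And>x. x \<in> P \<Longrightarrow> f x = \<phi> x"
      using \<P>(3)[OF P] by blast
    have "bounded P"
      using \<P>(2) P assms(2) by (meson Union_upper bounded_subset compact_imp_bounded)
    then have "compact (closure P)"
      by simp
    moreover have "continuous_on (closure P) \<phi>"
      using Ck_on_imp_continuous_on[OF V(2)] V(1) by (rule continuous_on_subset)
    ultimately have "bounded (\<phi> ` closure P)"
      by (intro compact_imp_bounded compact_continuous_image)
    moreover have "f ` P \<subseteq> \<phi> ` closure P"
      using V(3) closure_subset by fastforce
    ultimately show ?thesis
      by (rule bounded_subset)
  qed
  then have "bounded (\<Union>P\<in>\<P>. f ` P)"
    using \<P>(1) by blast
  also have "(\<Union>P\<in>\<P>. f ` P) = f ` \<Gamma>"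
    using \<P>(2) by blast
  finally show thesis
    using that unfolding bounded_iff by auto
qed

text \<open>Two nearby points may lie in different pieces, so their values are compared along a
  short path in the surface. The parameters at which the path is in the closure of a given piece
  form a closed set; finitely many such sets cover the unit interval, and the Lipschitz bounds on
  them combine without loss in the constant.\<close>

lemma piecewise_smooth_locally_lipschitz:
  assumes "piecewise_smooth k f \<Gamma>" "1 \<le> k" "compact \<Gamma>" "lipschitz_surface k \<Gamma>" "p \<in> \<Gamma>"
    "open V" "p \<in> V" "continuous_on (\<Gamma> \<inter> V) f"
  obtains \<delta> K where "0 < \<delta>" "K-lipschitz_on (\<Gamma> \<inter> ball p \<delta>) f"
proof -
  obtain \<P> where \<P>: "finite \<P>" "\<Union>\<P> = \<Gamma>"
    "\<And>P. P \<in> \<P> \<Longrightarrow> \<exists>V \<phi>. open V \<and> closure P \<subseteq> V \<and> Ck_on k \<phi> V \<and> (\<forall>x\<in>P. f x = \<phi> x)"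
    using assms(1) unfolding piecewise_smooth_def by blast
  have cl: "closure P \<subseteq> \<Gamma>" if "P \<in> \<P>" for P
    using that \<P>(2) assms(3) by (intro closure_minimal compact_imp_closed) auto
  have "\<exists>r K. 0 < r \<and> K-lipschitz_on (closure P \<inter> ball p r) f" if P: "P \<in> \<P>" for P
  proof (cases "p \<in> closure P")
    case True
    obtain W \<phi> where W: "open W" "closure P \<subseteq> W" "Ck_on k \<phi> W" "\<And>x. x \<in> P \<Longrightarrow> f x = \<phi> x"
      using \<P>(3)[OF P] by blast
    obtain r K where r: "0 < r" "ball p r \<subseteq> W" "K-lipschitz_on (ball p r) \<phi>"
      using C1_locally_lipschitz[OF W(3) assms(2) W(1)] True W(2) by blast
    obtain r' where r': "0 < r'" "ball p r' \<subseteq> V"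
      using assms(6,7) openE by blast
    have eq: "f x = \<phi> x" if "x \<in> closure P \<inter> ball p (min r r')" for x
    proof (rule eq_on_closure_of_piece[OF _ assms(8,6) Ck_on_imp_continuous_on[OF W(3)] W(1,4)])
      show "P \<subseteq> \<Gamma>"
        using \<P>(2) P by blast
      show "x \<in> closure P" "x \<in> \<Gamma> \<inter> V \<inter> W"
        using that r(2) r'(2) cl[OF P] by auto
    qed
    have "K-lipschitz_on (closure P \<inter> ball p (min r r')) \<phi>"
      using r(3) by (rule lipschitz_on_subset) auto
    then have "K-lipschitz_on (closure P \<inter> ball p (min r r')) f"
      using eq by (rule lipschitz_on_transform)
    then show ?thesis
      using r(1) r'(1) by (intro exI[of _ "min r r'"] exI[of _ K]) auto
  next
    case False
    \<comment> \<open>A piece away from \<open>p\<close> misses a whole ball around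
      \<open>p\<close>, so the Lipschitz bound there is vacuous.\<close>
    then obtain r where "0 < r" "ball p r \<subseteq> - closure P"
      using openE[of "- closure P" p] by auto
    then show ?thesis
      by (intro exI[of _ r] exI[of _ 0]) (auto intro!: lipschitz_onI)
  qed
  then obtain r K where rK: "\<And>P. P \<in> \<P> \<Longrightarrow> 0 < r P \<and> (K P)-lipschitz_on (closure P \<inter> ball p (r P)) f"
    by metis
  define \<epsilon> where "\<epsilon> = Min (insert 1 (r ` \<P>))"
  have \<epsilon>: "0 < \<epsilon>" "\<And>P. P \<in> \<P> \<Longrightarrow> \<epsilon> \<le> r P"
    using \<P>(1) rK by (auto simp: \<epsilon>_def)
  \<comment> \<open>The inserted 0 makes \<open>C\<close> nonnegative, as a Lipschitz constant has
    to be.\<close>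
  define C where "C = Max (insert 0 (K ` \<P>))"
  have C: "0 \<le> C" "\<And>P. P \<in> \<P> \<Longrightarrow> K P \<le> C"
    using \<P>(1) by (auto simp: C_def)
  have lipP: "C-lipschitz_on (closure P \<inter> ball p \<epsilon>) f" if "P \<in> \<P>" for P
    using rK[OF that] \<epsilon>(2)[OF that] C(2)[OF that]
    by (meson Int_mono lipschitz_on_le lipschitz_on_subset order_refl subset_ball)
  obtain \<delta> B where \<delta>: "0 < \<delta>" "0 \<le> B" and
    path: "\<And>x y. x \<in> \<Gamma> \<inter> ball p \<delta> \<Longrightarrow> y \<in> \<Gamma> \<inter> ball p \<delta> \<Longrightarrow>
       \<exists>g. g 0 = x \<and> g 1 = y \<and> (B * dist x y)-lipschitz_on {0..1::real} g \<and> g ` {0..1} \<subseteq> \<Gamma> \<inter> ball p \<epsilon>"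
    using lipschitz_surface_quasiconvex[OF assms(4,2,5) \<epsilon>(1)] by blast
  have "(C * B)-lipschitz_on (\<Gamma> \<inter> ball p \<delta>) f"
  proof (rule lipschitz_onI)
    fix x y assume "x \<in> \<Gamma> \<inter> ball p \<delta>" "y \<in> \<Gamma> \<inter> ball p \<delta>"
    then obtain g where g: "g 0 = x" "g 1 = y" "(B * dist x y)-lipschitz_on {0..1::real} g"
      "g ` {0..1} \<subseteq> \<Gamma> \<inter> ball p \<epsilon>"
      using path by blast
    \<comment> \<open>Preimages of closures rather than of the pieces themselves, since gluing along
      the interval requires closed sets.\<close>
    let ?T = "\<lambda>P. {0..1} \<inter> g -` closure P"
    have "(C * (B * dist x y))-lipschitz_on {0..1} (\<lambda>t. f (g t))"
    proof (rule lipschitz_on_closed_Union[where I = \<P> and U = ?T])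
      fix P assume P: "P \<in> \<P>"
      show "closed (?T P)"
        by (intro continuous_closed_preimage lipschitz_on_continuous_on[OF g(3)]) auto
      show "(C * (B * dist x y))-lipschitz_on (?T P) (\<lambda>t. f (g t))"
        by (rule lipschitz_on_compose2[OF lipschitz_on_subset[OF g(3)]])
          (use g(4) in \<open>auto intro!: lipschitz_on_subset[OF lipP[OF P]] simp: image_subset_iff\<close>)
    next
      show "{0..1} \<subseteq> (\<Union>P\<in>\<P>. ?T P)"
      proof
        fix t :: real assume t: "t \<in> {0..1}"
        then obtain P where "P \<in> \<P>" "g t \<in> P"
          using g(4) \<P>(2) by blast
        then show "t \<in> (\<Union>P\<in>\<P>. ?T P)"
          using t closure_subset[of P] by blast
      qed
    qed (use \<P>(1) C(1) \<delta>(2) in auto)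
    from lipschitz_onD[OF this, of 0 1] show "dist (f x) (f y) \<le> C * B * dist x y"
      by (simp add: g)
  qed (use C \<delta> in auto)
  with \<delta>(1) show thesis
    by (rule that)
qed

section \<open>Singular values and stability of the weighted fit\<close>

text \<open>By homogeneity, a nonzero vector is scaled to norm 1, where the infimum applies.\<close>

lemma min_singular_value_mult_le:
  "min_singular_value R J B * L2_set c J \<le> L2_set (mat_apply J B c) R"
proof (cases "L2_set c J = 0")
  case False
  define l where "l = L2_set c J"
  have l: "0 < l"
    using False L2_set_nonneg[of c J] unfolding l_def by linarith
  have "L2_set (\<lambda>j. (1 / l) * c j) J = 1"
    using l L2_set_right_distrib[of "1 / l" c J] by (simp add: l_def)
  then have "min_singular_value R J B \<le> L2_set (mat_apply J B (\<lambda>j. (1 / l) * c j)) R"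
    unfolding min_singular_value_def by (intro cINF_lower bdd_belowI2[of _ 0]) auto
  also have "mat_apply J B (\<lambda>j. (1 / l) * c j) = (\<lambda>i. (1 / l) * mat_apply J B c i)"
    by (simp add: mat_apply_def sum_divide_distrib fun_eq_iff)
  also have "L2_set \<dots> R = (1 / l) * L2_set (mat_apply J B c) R"
    using l by (intro L2_set_right_distrib[symmetric]) simp
  finally show ?thesis
    using l by (simp add: field_simps flip: l_def)
qed simp

text \<open>The supremum bounds its members only once the set is known to be bounded above; entries
  of a unit vector are at most 1 in absolute value, so the sum of all
  \<open>\<bar>B i j\<bar>\<close> is such a bound.\<close>

lemma le_max_singular_value:
  assumes "finite J" "L2_set c J = 1"
  shows "L2_set (mat_apply J B c) R \<le> max_singular_value R J B"
  unfolding max_singular_value_def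
proof (rule cSUP_upper)
  show "bdd_above ((\<lambda>c. L2_set (mat_apply J B c) R) ` {c. L2_set c J = 1})"
  proof (rule bdd_aboveI2)
    fix c assume c: "c \<in> {c. L2_set c J = 1}"
    have "\<bar>c j\<bar> \<le> 1" if "j \<in> J" for j
      using member_le_L2_set[OF assms(1) that, of "\<lambda>j. \<bar>c j\<bar>"] c by (simp add: L2_set_def)
    then have "\<bar>mat_apply J B c i\<bar> \<le> (\<Sum>j\<in>J. \<bar>B i j\<bar>)" for i
      unfolding mat_apply_def
      by (intro order_trans[OF sum_abs] sum_mono) (simp add: abs_mult mult_left_le)
    then show "L2_set (mat_apply J B c) R \<le> (\<Sum>i\<in>R. \<Sum>j\<in>J. \<bar>B i j\<bar>)"
      by (intro order_trans[OF L2_set_le_sum_abs] sum_mono)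
  qed
qed (use assms in simp)

lemma finite_quad_exps: "finite quad_exps"
  and card_quad_exps: "card quad_exps = 6"
  by (simp_all add: quad_exps_def)

text \<open>The scaled matrix maps the scaled deviation of \<open>c\<close> from the constant
  polynomial to the weighted residual of the fit plus the weighted oscillation of \<open>f\<close>.
  Each is at most \<open>\<delta>\<close> times the largest singular value, and the smallest one
  converts their sum into \<open>2 * \<kappa> * \<delta>\<close>.\<close>

lemma wls_fit_coefficient_bound:
  assumes fit: "wls_fit interp s f c"
    and cond: "condition_number_le (nodes s) quad_exps (scaled_vandermonde h s) \<kappa>"
    and h: "0 < h" and w: "\<And>d. 0 \<le> weight s d"
    and osc: "\<And>x. x \<in> nodes s \<Longrightarrow> \<bar>f x - f (center s)\<bar> \<le> \<delta>" and \<delta>: "0 \<le> \<delta>"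
  shows "L2_set (\<lambda>\<alpha>. (c \<alpha> - (if \<alpha> = (0,0) then f (center s) else 0)) * h ^ (fst \<alpha> + snd \<alpha>)) quad_exps
    \<le> 2 * \<kappa> * \<delta>"
proof -
  let ?N = "nodes s" and ?f0 = "f (center s)" and ?w = "node_weight s"
  let ?V = "vandermonde s" and ?B = "scaled_vandermonde h s"
  define c0 e :: "nat \<times> nat \<Rightarrow> real"
    where "c0 \<alpha> = (if \<alpha> = (0,0) then ?f0 else 0)" and "e \<alpha> = (if \<alpha> = (0,0) then 1 else 0)" for \<alpha>
  define d where "d \<alpha> = (c \<alpha> - c0 \<alpha>) * h ^ (fst \<alpha> + snd \<alpha>)" for \<alpha>
  define \<mu> \<nu> where "\<mu> = min_singular_value ?N quad_exps ?B" and "\<nu> = max_singular_value ?N quad_exps ?B"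
  have \<mu>: "0 < \<mu>" "\<nu> \<le> \<kappa> * \<mu>"
    using cond by (auto simp: condition_number_le_def \<mu>_def \<nu>_def pos_divide_le_eq)
  have w': "0 \<le> ?w x" for x
    using w by (simp add: node_weight_def)
  have V0: "mat_apply quad_exps ?V c0 x = ?f0" for x
    by (simp add: mat_apply_def quad_exps_def vandermonde_def c0_def)
  \<comment> \<open>The unit vector \<open>e\<close> selects the constant column, whose entries are
    the weights.\<close>
  have "L2_set e quad_exps = 1"
    by (simp add: L2_set_def quad_exps_def e_def)
  then have "L2_set (mat_apply quad_exps ?B e) ?N \<le> \<nu>"
    unfolding \<nu>_def by (rule le_max_singular_value[OF finite_quad_exps])
  also have "mat_apply quad_exps ?B e = ?w"
    by (simp add: mat_apply_def quad_exps_def scaled_vandermonde_def vandermonde_def e_def fun_eq_iff)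
  finally have \<nu>: "L2_set ?w ?N \<le> \<nu>" .
  have "L2_set (\<lambda>x. ?w x * (f x - ?f0)) ?N = L2_set (\<lambda>x. \<bar>?w x * (f x - ?f0)\<bar>) ?N"
    by (simp add: L2_set_def)
  also have "\<dots> \<le> L2_set (\<lambda>x. \<delta> * ?w x) ?N"
    using osc w' by (intro L2_set_mono) (auto simp: abs_mult mult.commute[of \<delta>] intro: mult_left_mono)
  also have "\<dots> = \<delta> * L2_set ?w ?N"
    using \<delta> by (simp add: L2_set_right_distrib)
  also have "\<dots> \<le> \<delta> * \<nu>"
    using \<nu> \<delta> by (rule mult_left_mono)
  finally have dev: "L2_set (\<lambda>x. ?w x * (f x - ?f0)) ?N \<le> \<delta> * \<nu>" .
  \<comment> \<open>\<open>c0\<close> has the value at the center as constant coefficient, so it is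
    an admissible competitor under both conventions for \<open>interp\<close>.\<close>
  have "wls_residual s f c \<le> wls_residual s f c0"
    using fit by (auto simp: wls_fit_def c0_def)
  also have "\<dots> = L2_set (\<lambda>x. ?w x * (f x - ?f0)) ?N"
    unfolding wls_residual_def V0 L2_set_def by (simp add: power_mult_distrib power2_commute)
  finally have res: "wls_residual s f c \<le> \<delta> * \<nu>"
    using dev by simp
  \<comment> \<open>The powers of \<open>h\<close> in \<open>d\<close> cancel those dividing the
    columns of the scaled matrix.\<close>
  have B: "mat_apply quad_exps ?B d x
      = ?w x * (mat_apply quad_exps ?V c x - f x) + ?w x * (f x - ?f0)" for x
  proof -
    have "mat_apply quad_exps ?B d x = (\<Sum>\<alpha>\<in>quad_exps. ?w x * (?V x \<alpha> * c \<alpha> - ?V x \<alpha> * c0 \<alpha>))"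
      unfolding mat_apply_def
      using h by (intro sum.cong) (simp_all add: scaled_vandermonde_def d_def algebra_simps)
    also have "\<dots> = ?w x * (mat_apply quad_exps ?V c x - mat_apply quad_exps ?V c0 x)"
      by (simp add: mat_apply_def sum_subtractf flip: sum_distrib_left)
    finally show ?thesis
      by (simp add: V0 algebra_simps)
  qed
  have "\<mu> * L2_set d quad_exps \<le> L2_set (mat_apply quad_exps ?B d) ?N"
    unfolding \<mu>_def by (rule min_singular_value_mult_le)
  also have "\<dots> \<le> wls_residual s f c + L2_set (\<lambda>x. ?w x * (f x - ?f0)) ?N"
    unfolding wls_residual_def B by (rule L2_set_triangle_ineq)
  also have "\<dots> \<le> 2 * \<delta> * \<nu>"
    using res dev by simp
  also have "\<dots> \<le> 2 * \<delta> * (\<kappa> * \<mu>)"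
    using \<mu>(2) \<delta> by (intro mult_left_mono) auto
  finally have "\<mu> * L2_set d quad_exps \<le> \<mu> * (2 * \<kappa> * \<delta>)"
    by (simp add: mult_ac)
  then have "L2_set d quad_exps \<le> 2 * \<kappa> * \<delta>"
    using \<mu>(1) by simp
  then show ?thesis
    by (simp add: d_def[abs_def] c0_def)
qed

text \<open>Local coordinates are at most the distance from the center, hence \<open>O(h)\<close>,
  which offsets the powers of \<open>h\<close> in the coefficient bound. Each of the 6 monomials
  contributes at most \<open>(1 + \<rho>)\<^sup>2 * (2 * \<kappa> * \<delta>)\<close>, whence the
  factor 12.\<close>

lemma fit_eval_near_center_value:
  assumes fit: "wls_fit interp s f c"
    and cond: "condition_number_le (nodes s) quad_exps (scaled_vandermonde h s) \<kappa>"
    and h: "0 < h" and w: "\<And>d. 0 \<le> weight s d"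
    and osc: "\<And>x. x \<in> nodes s \<Longrightarrow> \<bar>f x - f (center s)\<bar> \<le> \<delta>" and \<delta>: "0 \<le> \<delta>"
    and axes: "norm (axis1 s) = 1" "norm (axis2 s) = 1"
    and x: "dist (center s) x \<le> \<rho> * h"
  shows "\<bar>fit_eval s c x - f (center s)\<bar> \<le> 12 * (1 + \<rho>)\<^sup>2 * \<kappa> * \<delta>"
proof -
  define c0 :: "nat \<times> nat \<Rightarrow> real" where "c0 \<alpha> = (if \<alpha> = (0,0) then f (center s) else 0)" for \<alpha>
  define d where "d \<alpha> = (c \<alpha> - c0 \<alpha>) * h ^ (fst \<alpha> + snd \<alpha>)" for \<alpha>
  define u where "u = local_coords s x"
  have "0 \<le> \<rho> * h"
    by (rule order_trans[OF zero_le_dist x])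
  then have \<rho>: "0 \<le> \<rho>"
    using h by (simp add: zero_le_mult_iff)
  have u: "\<bar>u $ i\<bar> / h \<le> 1 + \<rho>" for i
  proof -
    have "\<bar>axis1 s \<bullet> (x - center s)\<bar> \<le> \<rho> * h" "\<bar>axis2 s \<bullet> (x - center s)\<bar> \<le> \<rho> * h"
      using Cauchy_Schwarz_ineq2[of "axis1 s" "x - center s"]
        Cauchy_Schwarz_ineq2[of "axis2 s" "x - center s"] axes x
      by (auto simp: dist_norm norm_minus_commute)
    moreover have "i = 1 \<or> i = 2"
      by (rule exhaust_2)
    ultimately have "\<bar>u $ i\<bar> \<le> \<rho> * h"
      by (auto simp: u_def local_coords_def vector_2)
    \<comment> \<open>Passing to a base of at least 1 lets the square dominate all powers of degree
      at most 2.\<close>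
    also have "\<dots> \<le> (1 + \<rho>) * h"
      using h by simp
    finally show ?thesis
      using h by (simp add: pos_divide_le_eq)
  qed
  have bound: "\<bar>vandermonde s x \<alpha> * (c \<alpha> - c0 \<alpha>)\<bar> \<le> (1 + \<rho>)\<^sup>2 * (2 * \<kappa> * \<delta>)" if \<alpha>: "\<alpha> \<in> quad_exps" for \<alpha>
  proof -
    have "\<bar>d \<alpha>\<bar> \<le> L2_set (\<lambda>\<alpha>. \<bar>d \<alpha>\<bar>) quad_exps"
      using finite_quad_exps \<alpha> by (rule member_le_L2_set)
    also have "\<dots> = L2_set d quad_exps"
      by (simp add: L2_set_def)
    also have "\<dots> \<le> 2 * \<kappa> * \<delta>"
      using wls_fit_coefficient_bound[OF fit cond h w osc \<delta>] by (simp add: d_def[abs_def] c0_def)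
    finally have d: "\<bar>d \<alpha>\<bar> \<le> 2 * \<kappa> * \<delta>" .
    have "(\<bar>u $ 1\<bar> / h) ^ fst \<alpha> * (\<bar>u $ 2\<bar> / h) ^ snd \<alpha> \<le> (1 + \<rho>) ^ fst \<alpha> * (1 + \<rho>) ^ snd \<alpha>"
      using u h \<rho> by (intro mult_mono power_mono) auto
    also have "\<dots> = (1 + \<rho>) ^ (fst \<alpha> + snd \<alpha>)"
      by (simp add: power_add)
    also have "\<dots> \<le> (1 + \<rho>) ^ 2"
      using \<alpha> \<rho> by (intro power_increasing) (auto simp: quad_exps_def)
    finally have V: "(\<bar>u $ 1\<bar> / h) ^ fst \<alpha> * (\<bar>u $ 2\<bar> / h) ^ snd \<alpha> \<le> (1 + \<rho>)\<^sup>2" .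
    have "\<bar>vandermonde s x \<alpha> * (c \<alpha> - c0 \<alpha>)\<bar>
        = (\<bar>u $ 1\<bar> / h) ^ fst \<alpha> * (\<bar>u $ 2\<bar> / h) ^ snd \<alpha> * \<bar>d \<alpha>\<bar>"
      using h by (simp add: vandermonde_def d_def u_def abs_mult power_abs power_add power_divide)
    also have "\<dots> \<le> (1 + \<rho>)\<^sup>2 * (2 * \<kappa> * \<delta>)"
      using V d by (intro mult_mono) auto
    finally show ?thesis .
  qed
  have "fit_eval s c x - f (center s) = mat_apply quad_exps (vandermonde s) c x
      - mat_apply quad_exps (vandermonde s) c0 x"
    by (simp add: fit_eval_eq_vandermonde) (simp add: mat_apply_def quad_exps_def vandermonde_def c0_def)
  also have "\<dots> = (\<Sum>\<alpha>\<in>quad_exps. vandermonde s x \<alpha> * (c \<alpha> - c0 \<alpha>))"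
    by (simp add: mat_apply_def sum_subtractf right_diff_distrib)
  also have "\<bar>\<dots>\<bar> \<le> (\<Sum>\<alpha>\<in>quad_exps. (1 + \<rho>)\<^sup>2 * (2 * \<kappa> * \<delta>))"
    using bound by (intro order_trans[OF sum_abs] sum_mono)
  also have "\<dots> = 12 * (1 + \<rho>)\<^sup>2 * \<kappa> * \<delta>"
    by (simp add: card_quad_exps)
  finally show ?thesis .
qed

section \<open>Interpolation on a single element\<close>

text \<open>On the reference cell the shape functions are nonnegative with sum 1, so interpolation
  is a convex combination. The general codomain covers both nodal values and vertex
  positions.\<close>

lemma elem_interp_near:
  fixes F :: "'v \<Rightarrow> 'b::real_normed_vector"
  assumes "length \<sigma> \<in> {3, 4}" "\<xi> \<in> ref_cell \<sigma>" "\<And>v. v \<in> set \<sigma> \<Longrightarrow> norm (F v - a) \<le> \<delta>"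
  shows "norm (elem_interp \<sigma> F \<xi> - a) \<le> \<delta>"
proof -
  let ?w = "\<lambda>i. shape_functions \<sigma> \<xi> ! i"
  have nonneg: "0 \<le> ?w i" if "i < length \<sigma>" for i
    using assms(1,2) that
    by (cases \<xi>) (auto simp: ref_cell_def shape_functions_def less_Suc_eq numeral_eq_Suc)
  have sum: "(\<Sum>i<length \<sigma>. ?w i) = 1"
    using assms(1)
    by (cases \<xi>) (auto simp: shape_functions_def numeral_eq_Suc algebra_simps)
  have "elem_interp \<sigma> F \<xi> - a = elem_interp \<sigma> F \<xi> - (\<Sum>i<length \<sigma>. ?w i) *\<^sub>R a"
    by (simp add: sum)
  also have "\<dots> = (\<Sum>i<length \<sigma>. ?w i *\<^sub>R (F (\<sigma> ! i) - a))"
    by (simp add: elem_interp_def scaleR_sum_left sum_subtractf scaleR_diff_right)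
  also have "norm \<dots> \<le> (\<Sum>i<length \<sigma>. ?w i * \<delta>)"
    using nonneg assms(3) by (intro sum_norm_le) (auto intro: mult_left_mono)
  also have "\<dots> = \<delta>"
    by (simp add: sum flip: sum_distrib_right)
  finally show ?thesis .
qed

text \<open>Any two vertices of a triangle or quadrilateral are joined by at most two edges, and a
  point of the element is a convex combination of its vertices.\<close>

lemma elem_vertex_near_point:
  assumes "length \<sigma> \<in> {3, 4}" "\<xi> \<in> ref_cell \<sigma>"
    and edge: "\<And>i. i < length \<sigma> \<Longrightarrow> dist (\<sigma> ! i) (\<sigma> ! (Suc i mod length \<sigma>)) \<le> l"
    and v: "v \<in> set \<sigma>"
  shows "dist (elem_point \<sigma> \<xi>) v \<le> 2 * l"
proof -
  have "dist (\<sigma> ! 0) (\<sigma> ! (Suc 0 mod length \<sigma>)) \<le> l"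
    using assms(1) by (intro edge) auto
  then have l: "0 \<le> l"
    by (rule order_trans[OF zero_le_dist])
  have two: "dist x z \<le> 2 * l" if "dist x y \<le> l" "dist y z \<le> l" for x y z :: "real^3"
    using that dist_triangle[of x z y] by simp
  consider a b c where "\<sigma> = [a, b, c]" | a b c d where "\<sigma> = [a, b, c, d]"
    using assms(1) by (auto simp: numeral_eq_Suc length_Suc_conv)
  then have "\<And>v'. v' \<in> set \<sigma> \<Longrightarrow> dist v' v \<le> 2 * l"
  proof cases
    case 1
    have "dist a b \<le> l" "dist b c \<le> l" "dist c a \<le> l"
      using edge[of 0] edge[of 1] edge[of 2] unfolding 1 by simp_all
    moreover fix v' assume "v' \<in> set \<sigma>"
    ultimately show "dist v' v \<le> 2 * l"
      using v l unfolding 1 by (auto simp: dist_commute)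
  next
    case 2
    have e: "dist a b \<le> l" "dist b c \<le> l" "dist c d \<le> l" "dist d a \<le> l"
      using edge[of 0] edge[of 1] edge[of 2] edge[of 3] unfolding 2 by simp_all
    have "dist a c \<le> 2 * l" "dist b d \<le> 2 * l"
      using two[OF e(1,2)] two[OF e(2,3)] .
    moreover fix v' assume "v' \<in> set \<sigma>"
    ultimately show "dist v' v \<le> 2 * l"
      using v l e unfolding 2 by (auto simp: dist_commute)
  qed
  then show ?thesis
    unfolding dist_norm by (rule elem_interp_near[OF assms(1,2)])
qed

lemma edge_length_le_Max:
  assumes "finite M" "\<sigma> \<in> M" "i < length \<sigma>"
  shows "dist (\<sigma> ! i) (\<sigma> ! (Suc i mod length \<sigma>)) \<le> Max (edge_lengths M)"
proof (rule Max_ge)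
  have "edge_lengths M
      = (\<lambda>(\<sigma>, i). dist (\<sigma> ! i) (\<sigma> ! (Suc i mod length \<sigma>))) ` (SIGMA \<sigma>:M. {..<length \<sigma>})"
    by (auto simp: edge_lengths_def image_iff)
  then show "finite (edge_lengths M)"
    using assms(1) by simp
  show "dist (\<sigma> ! i) (\<sigma> ! (Suc i mod length \<sigma>)) \<in> edge_lengths M"
    using assms(2,3) by (auto simp: edge_lengths_def)
qed

section \<open>Comparison of the fit with the interpolant\<close>

text \<open>Both approximations are compared with the value at the stencil center. The radius
  \<open>3 * \<rho> * h\<close> reaches the element vertices: \<open>\<rho> * h\<close> from the
  center to the evaluation point and \<open>2 * \<rho> * h\<close> on to a vertex. The summand 1 in
  the constant is the share of the interpolant.\<close>

lemma fit_interp_difference_le_oscillation: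
  assumes mesh: "is_mesh \<Gamma> M" "edge_length_measure \<rho> M h" and \<sigma>: "\<sigma> \<in> M" "\<xi> \<in> ref_cell \<sigma>"
    and s: "admissible_stencil \<Gamma> M h \<rho> \<kappa> s" "dist (center s) (elem_point \<sigma> \<xi>) \<le> \<rho> * h"
    and fit: "wls_fit interp s f c"
    and osc: "\<And>y. y \<in> \<Gamma> \<Longrightarrow> dist (center s) y \<le> 3 * \<rho> * h \<Longrightarrow> \<bar>f y - f (center s)\<bar> \<le> \<delta>"
  shows "\<bar>fit_eval s c (elem_point \<sigma> \<xi>) - elem_interp \<sigma> f \<xi>\<bar> \<le> (12 * (1 + \<rho>)\<^sup>2 * \<kappa> + 1) * \<delta>"
proof -
  have h: "0 < h" and edges: "Max (edge_lengths M) \<le> \<rho> * h"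
    using mesh(2) by (auto simp: edge_length_measure_def)
  have \<rho>h: "0 \<le> \<rho> * h"
    by (rule order_trans[OF zero_le_dist s(2)])
  have len: "length \<sigma> \<in> {3, 4}" and sub: "\<And>\<tau>. \<tau> \<in> M \<Longrightarrow> set \<tau> \<subseteq> \<Gamma>" and fin: "finite M"
    using mesh(1) \<sigma>(1) by (auto simp: is_mesh_def)
  have center: "center s \<in> \<Gamma>" and sub_nodes: "nodes s \<subseteq> (\<Union>\<sigma>\<in>M. set \<sigma>)"
    and dist_nodes: "\<And>x. x \<in> nodes s \<Longrightarrow> dist (center s) x \<le> \<rho> * h" and w: "\<And>d. 0 \<le> weight s d"
    and axes: "norm (axis1 s) = 1" "norm (axis2 s) = 1"
    and cond: "condition_number_le (nodes s) quad_exps (scaled_vandermonde h s) \<kappa>"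
    using s(1) unfolding admissible_stencil_def tangent_frame_def mesh_nodes_def by blast+
  \<comment> \<open>The oscillation bound is applied to the center itself.\<close>
  have \<delta>: "0 \<le> \<delta>"
    using osc[OF center] \<rho>h by simp
  have nodes: "\<bar>f x - f (center s)\<bar> \<le> \<delta>" if "x \<in> nodes s" for x
  proof (rule osc)
    show "x \<in> \<Gamma>"
      using that sub_nodes sub by blast
    show "dist (center s) x \<le> 3 * \<rho> * h"
      using dist_nodes[OF that] \<rho>h by simp
  qed
  have "\<bar>fit_eval s c (elem_point \<sigma> \<xi>) - f (center s)\<bar> \<le> 12 * (1 + \<rho>)\<^sup>2 * \<kappa> * \<delta>"
    by (rule fit_eval_near_center_value[OF fit cond h w nodes \<delta> axes s(2)])
  moreover have "norm (elem_interp \<sigma> f \<xi> - f (center s)) \<le> \<delta>"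
  proof (rule elem_interp_near[OF len \<sigma>(2)])
    fix v assume v: "v \<in> set \<sigma>"
    have "dist (elem_point \<sigma> \<xi>) v \<le> 2 * (\<rho> * h)"
      using edge_length_le_Max[OF fin \<sigma>(1)] edges
      by (intro elem_vertex_near_point[OF len \<sigma>(2) _ v]) (rule order_trans)
    then have "dist (center s) v \<le> 3 * \<rho> * h"
      using s(2) dist_triangle[of "center s" v "elem_point \<sigma> \<xi>"] by simp
    then show "norm (f v - f (center s)) \<le> \<delta>"
      using osc v sub[OF \<sigma>(1)] by auto
  qed
  ultimately show ?thesis
    by (simp add: algebra_simps)
qed

theorem proposition5:
  fixes \<Gamma> :: "(real^3) set" and f :: "real^3 \<Rightarrow> real" and p :: "real^3" and k :: nat
    and M :: "nat \<Rightarrow> (real^3) list set" and h :: "nat \<Rightarrow> real" and \<rho> \<kappa> :: real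
  assumes "1 \<le> k" and "compact \<Gamma>" and "lipschitz_surface k \<Gamma>"
    and "piecewise_smooth k f \<Gamma>"
    and "\<And>n. is_mesh \<Gamma> (M n)"
    and "\<And>n. edge_length_measure \<rho> (M n) (h n)"
    and "h \<longlonglongrightarrow> 0"
  shows "(C0_discontinuity f \<Gamma> p \<longrightarrow>
            (\<exists>U. open U \<and> p \<in> U \<and> fit_interp_difference_bigo \<Gamma> f M h \<rho> \<kappa> U (\<lambda>_. 1))) \<and>
         (C1_discontinuity f \<Gamma> p \<longrightarrow>
            (\<exists>U. open U \<and> p \<in> U \<and> fit_interp_difference_bigo \<Gamma> f M h \<rho> \<kappa> U h))"
proof (intro conjI impI)
  let ?A = "12 * (1 + \<rho>)\<^sup>2 * \<kappa> + 1"
  obtain C where C: "\<And>x. x \<in> \<Gamma> \<Longrightarrow> \<bar>f x\<bar> \<le> C"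
    using piecewise_smooth_bounded[OF assms(4,2)] by blast
  \<comment> \<open>Since \<open>f\<close> is bounded by \<open>C\<close> on the surface, its
    oscillation about any center is at most \<open>2 * C\<close>, so \<open>UNIV\<close> serves as
    the neighborhood.\<close>
  have "fit_interp_difference_bigo \<Gamma> f M h \<rho> \<kappa> UNIV (\<lambda>_. 1)"
    unfolding fit_interp_difference_bigo_def
  proof (intro exI[of _ "?A * (2 * C)"] always_eventually allI ballI impI)
    fix n \<sigma> \<xi> s interp c
    assume \<sigma>: "\<sigma> \<in> M n" "\<xi> \<in> ref_cell \<sigma>" and s: "admissible_stencil \<Gamma> (M n) (h n) \<rho> \<kappa> s"
      "dist (center s) (elem_point \<sigma> \<xi>) \<le> \<rho> * h n" and fit: "wls_fit interp s f c"
    have "center s \<in> \<Gamma>"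
      using s(1) by (simp add: admissible_stencil_def)
    then have "\<bar>f y - f (center s)\<bar> \<le> 2 * C" if "y \<in> \<Gamma>" for y
      using C[OF that] C[of "center s"] by linarith
    then have "\<bar>fit_eval s c (elem_point \<sigma> \<xi>) - elem_interp \<sigma> f \<xi>\<bar> \<le> ?A * (2 * C)"
      by (intro fit_interp_difference_le_oscillation[OF assms(5,6) \<sigma> s fit])
    then show "\<bar>fit_eval s c (elem_point \<sigma> \<xi>) - elem_interp \<sigma> f \<xi>\<bar> \<le> ?A * (2 * C) * \<bar>1\<bar>"
      by simp
  qed
  then show "\<exists>U. open U \<and> p \<in> U \<and> fit_interp_difference_bigo \<Gamma> f M h \<rho> \<kappa> U (\<lambda>_. 1)"
    by (intro exI[of _ UNIV]) auto
next
  let ?A = "12 * (1 + \<rho>)\<^sup>2 * \<kappa> + 1"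
  assume "C1_discontinuity f \<Gamma> p"
  then obtain V where p: "p \<in> \<Gamma>" and V: "open V" "p \<in> V" "continuous_on (\<Gamma> \<inter> V) f"
    by (auto simp: C1_discontinuity_def)
  obtain \<delta> K where \<delta>: "0 < \<delta>" and K: "K-lipschitz_on (\<Gamma> \<inter> ball p \<delta>) f"
    using piecewise_smooth_locally_lipschitz[OF assms(4,1,2,3) p V] by blast
  have "(\<lambda>n. 4 * \<rho> * h n) \<longlonglongrightarrow> 4 * \<rho> * 0"
    using assms(7) by (intro tendsto_intros)
  \<comment> \<open>The center lies within \<open>\<delta> / 2 + \<rho> * h n\<close> of
    \<open>p\<close>, and the points compared with it lie another \<open>3 * \<rho> * h n\<close>
    away at most; all of them must stay in \<open>ball p \<delta>\<close>, where \<open>f\<close> is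
    Lipschitz.\<close>
  then have small: "\<forall>\<^sub>F n in sequentially. 4 * \<rho> * h n < \<delta> / 2"
    using \<delta> by (intro order_tendstoD) auto
  have "fit_interp_difference_bigo \<Gamma> f M h \<rho> \<kappa> (ball p (\<delta> / 2)) h"
    unfolding fit_interp_difference_bigo_def
  proof (intro exI[of _ "?A * (K * (3 * \<rho>))"] eventually_mono[OF small] allI ballI impI)
    fix n \<sigma> \<xi> s interp c
    assume n: "4 * \<rho> * h n < \<delta> / 2" and \<sigma>: "\<sigma> \<in> M n" "\<xi> \<in> ref_cell \<sigma>"
      and U: "elem_point \<sigma> \<xi> \<in> ball p (\<delta> / 2)"
      and s: "admissible_stencil \<Gamma> (M n) (h n) \<rho> \<kappa> s"
      "dist (center s) (elem_point \<sigma> \<xi>) \<le> \<rho> * h n" and fit: "wls_fit interp s f c"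
    have h: "0 < h n"
      using assms(6)[of n] by (simp add: edge_length_measure_def)
    have \<rho>h: "0 \<le> \<rho> * h n"
      by (rule order_trans[OF zero_le_dist s(2)])
    have center: "center s \<in> \<Gamma>"
      using s(1) by (simp add: admissible_stencil_def)
    have near: "dist p (center s) < \<delta> / 2 + \<rho> * h n"
      using U s(2) dist_triangle[of p "center s" "elem_point \<sigma> \<xi>"] by (simp add: dist_commute)
    \<comment> \<open>The Lipschitz bound over a region of radius \<open>3 * \<rho> * h n\<close>
      supplies the factor \<open>h n\<close> of the final estimate.\<close>
    have "\<bar>f y - f (center s)\<bar> \<le> K * (3 * \<rho> * h n)"
      if y: "y \<in> \<Gamma>" "dist (center s) y \<le> 3 * \<rho> * h n" for y
    proof -
      have "dist p y < \<delta>" "dist p (center s) < \<delta>"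
        using near y(2) n \<rho>h dist_triangle[of p y "center s"] by auto
      then have "dist (f y) (f (center s)) \<le> K * dist y (center s)"
        using y(1) center by (intro lipschitz_onD[OF K]) auto
      also have "\<dots> \<le> K * (3 * \<rho> * h n)"
        using y(2) lipschitz_on_nonneg[OF K] by (intro mult_left_mono) (simp_all add: dist_commute)
      finally show ?thesis
        by (simp add: dist_real_def)
    qed
    then have "\<bar>fit_eval s c (elem_point \<sigma> \<xi>) - elem_interp \<sigma> f \<xi>\<bar> \<le> ?A * (K * (3 * \<rho> * h n))"
      by (rule fit_interp_difference_le_oscillation[OF assms(5,6) \<sigma> s fit])
    then show "\<bar>fit_eval s c (elem_point \<sigma> \<xi>) - elem_interp \<sigma> f \<xi>\<bar> \<le> ?A * (K * (3 * \<rho>)) * \<bar>h n\<bar>"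
      using h by (simp add: mult.assoc)
  qed
  then show "\<exists>U. open U \<and> p \<in> U \<and> fit_interp_difference_bigo \<Gamma> f M h \<rho> \<kappa> U h"
    using \<delta> by (intro exI[of _ "ball p (\<delta> / 2)"]) auto
qed

end
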